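(* Let $S$ be a set. A set $P$ of $S$-probabilities is a specific set of $S$-probabilities all of whose elements are varying if and only if $P$ is an infimum faithful algebra of $S$-probabilities.
   Context: An $S$-probability is a function $p\colon S\to[0,1]$; sets of them are ordered pointwise, $0,1$ are the constant functions, $p':=1-p$, sums are pointwise; $\wedge,\vee$ denote infimum and supremum in $P$ (when they exist). $p\wedge q=0$ means that the only $x\in P$ with $x\le p,q$ is $x=0$; $p\perp q$ means $p\le 1-q$. $P$ is specific if (1) $0,1\in P$; (2) $p\in P\Rightarrow 1-p\in P$; (3) $p,q\in P$, $p\wedge q=0\Rightarrow p+q\in P$. $p$ is varying if $p\le 1/2$ pointwise or $p\ge1/2$ pointwise implies $p\in\{0,1\}$. $P$ is an algebra of $S$-probabilities if it satisfies (1), (2) and (5): $p,q,r\in P$ pairwise orthogonal $\Rightarrow p+q+r\in P$ (such $P$ is an orthomodular poset). Elements $p,q$ commute if $p=(p\wedge q)\vee(p\wedge q')$ (all these existing in $P$). $P$ is infimum faithful if for all $p,q\in P$: $p\wedge q$ exists in $P$ if and only if $p$ and $q$ commute. *)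

theory Defs
  imports Complex_Main
begin

text \<open>S-probabilities on a set S are represented extensionally: functions
  's => real with values in [0,1] on S and value 0 outside S.\<close>

definition sprob :: "'s set \<Rightarrow> ('s \<Rightarrow> real) \<Rightarrow> bool" where
  "sprob S p \<longleftrightarrow> (\<forall>x\<in>S. 0 \<le> p x \<and> p x \<le> 1) \<and> (\<forall>x. x \<notin> S \<longrightarrow> p x = 0)"

definition leS :: "'s set \<Rightarrow> ('s \<Rightarrow> real) \<Rightarrow> ('s \<Rightarrow> real) \<Rightarrow> bool" where
  "leS S p q \<longleftrightarrow> (\<forall>x\<in>S. p x \<le> q x)"

definition zeroS :: "'s set \<Rightarrow> 's \<Rightarrow> real" where
  "zeroS S = (\<lambda>x. 0)"

definition oneS :: "'s set \<Rightarrow> 's \<Rightarrow> real" where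
  "oneS S = (\<lambda>x. if x \<in> S then 1 else 0)"

definition complS :: "'s set \<Rightarrow> ('s \<Rightarrow> real) \<Rightarrow> 's \<Rightarrow> real" where
  "complS S p = (\<lambda>x. if x \<in> S then 1 - p x else 0)"

definition addS :: "'s set \<Rightarrow> ('s \<Rightarrow> real) \<Rightarrow> ('s \<Rightarrow> real) \<Rightarrow> 's \<Rightarrow> real" where
  "addS S p q = (\<lambda>x. if x \<in> S then p x + q x else 0)"

definition is_inf :: "'s set \<Rightarrow> ('s \<Rightarrow> real) set \<Rightarrow> ('s \<Rightarrow> real) \<Rightarrow> ('s \<Rightarrow> real) \<Rightarrow> ('s \<Rightarrow> real) \<Rightarrow> bool" where
  "is_inf S P p q r \<longleftrightarrow> r \<in> P \<and> leS S r p \<and> leS S r q \<and>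
     (\<forall>x\<in>P. leS S x p \<and> leS S x q \<longrightarrow> leS S x r)"

definition is_sup :: "'s set \<Rightarrow> ('s \<Rightarrow> real) set \<Rightarrow> ('s \<Rightarrow> real) \<Rightarrow> ('s \<Rightarrow> real) \<Rightarrow> ('s \<Rightarrow> real) \<Rightarrow> bool" where
  "is_sup S P p q r \<longleftrightarrow> r \<in> P \<and> leS S p r \<and> leS S q r \<and>
     (\<forall>x\<in>P. leS S p x \<and> leS S q x \<longrightarrow> leS S r x)"

definition meet_zero :: "'s set \<Rightarrow> ('s \<Rightarrow> real) set \<Rightarrow> ('s \<Rightarrow> real) \<Rightarrow> ('s \<Rightarrow> real) \<Rightarrow> bool" where
  "meet_zero S P p q \<longleftrightarrow> (\<forall>x\<in>P. leS S x p \<and> leS S x q \<longrightarrow> x = zeroS S)"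

definition orth :: "'s set \<Rightarrow> ('s \<Rightarrow> real) \<Rightarrow> ('s \<Rightarrow> real) \<Rightarrow> bool" where
  "orth S p q \<longleftrightarrow> leS S p (complS S q)"

definition specific :: "'s set \<Rightarrow> ('s \<Rightarrow> real) set \<Rightarrow> bool" where
  "specific S P \<longleftrightarrow> (\<forall>p\<in>P. sprob S p) \<and>
     zeroS S \<in> P \<and> oneS S \<in> P \<and>
     (\<forall>p\<in>P. complS S p \<in> P) \<and>
     (\<forall>p\<in>P. \<forall>q\<in>P. meet_zero S P p q \<longrightarrow> addS S p q \<in> P)"

definition varying :: "'s set \<Rightarrow> ('s \<Rightarrow> real) \<Rightarrow> bool" where
  "varying S p \<longleftrightarrow>
     ((\<forall>x\<in>S. p x \<le> 1/2) \<or> (\<forall>x\<in>S. p x \<ge> 1/2)) \<longrightarrow> p = zeroS S \<or> p = oneS S"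

definition prob_algebra :: "'s set \<Rightarrow> ('s \<Rightarrow> real) set \<Rightarrow> bool" where
  "prob_algebra S P \<longleftrightarrow> (\<forall>p\<in>P. sprob S p) \<and>
     zeroS S \<in> P \<and> oneS S \<in> P \<and>
     (\<forall>p\<in>P. complS S p \<in> P) \<and>
     (\<forall>p\<in>P. \<forall>q\<in>P. \<forall>r\<in>P. orth S p q \<and> orth S p r \<and> orth S q r
        \<longrightarrow> addS S (addS S p q) r \<in> P)"

definition commute :: "'s set \<Rightarrow> ('s \<Rightarrow> real) set \<Rightarrow> ('s \<Rightarrow> real) \<Rightarrow> ('s \<Rightarrow> real) \<Rightarrow> bool" where
  "commute S P p q \<longleftrightarrow> (\<exists>a b. is_inf S P p q a \<and> is_inf S P p (complS S q) b \<and>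
     is_sup S P a b p)"

definition inf_faithful :: "'s set \<Rightarrow> ('s \<Rightarrow> real) set \<Rightarrow> bool" where
  "inf_faithful S P \<longleftrightarrow> (\<forall>p\<in>P. \<forall>q\<in>P. (\<exists>r. is_inf S P p q r) \<longleftrightarrow> commute S P p q)"

end

theory Submission
  imports Defs
begin

text \<open>
  The only delicate point is that in a specific set of varying S-probabilities three pairwise
  orthogonal elements \<open>p, q, r\<close> have a sum in \<open>P\<close>. Three observations are used: an element that is
  at most \<open>1/2\<close> everywhere vanishes; two elements that are not orthogonal have a nonzero common lower
  bound; and if \<open>a * p + b * q \<le> (a + b) / 2\<close> for some positive weights, then every common lower
  bound of \<open>p\<close> and \<open>q\<close> is at most \<open>1/2\<close>, so \<open>p\<close> and \<open>q\<close> are orthogonal. If the sum \<open>p + q + r\<close> is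
  not in \<open>P\<close>, then \<open>p + q\<close> and \<open>r\<close> have a common lower bound \<open>x \<noteq> 0\<close>. Put \<open>t = 1 - p - q\<close>. One
  finds successively nonzero elements \<open>z \<le> t, p + x, q + x\<close> and \<open>w \<le> p, x + z\<close>, and the estimate
  \<open>3 * z + (1 - x - z + w) \<le> 2\<close> then forces \<open>w \<le> x \<le> 1 - p \<le> 1 - w\<close>, a contradiction.
\<close>

section \<open>Pointwise equality and orthogonality\<close>

lemma sprob_eqI:
  assumes "sprob S p" "sprob S q" "\<And>s. s \<in> S \<Longrightarrow> p s = q s"
  shows "p = q"
proof
  fix s show "p s = q s"
    using assms by (cases "s \<in> S") (auto simp: sprob_def)
qed

lemma sprob_zeroS: "sprob S (zeroS S)"
  by (simp add: sprob_def zeroS_def)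

lemma orth_iff: "orth S p q \<longleftrightarrow> (\<forall>s\<in>S. p s + q s \<le> 1)"
  by (auto simp: orth_def leS_def complS_def algebra_simps)

section \<open>From specific sets of varying elements to algebras\<close>

locale specific_varying =
  fixes S :: "'s set" and P :: "('s \<Rightarrow> real) set"
  assumes specific: "specific S P" and varying: "\<And>p. p \<in> P \<Longrightarrow> varying S p"
begin

lemma sprob: "p \<in> P \<Longrightarrow> sprob S p"
  using specific by (simp add: specific_def)

lemma complS_mem: "p \<in> P \<Longrightarrow> complS S p \<in> P"
  using specific by (simp add: specific_def)

lemma eq_zeroI:
  assumes "p \<in> P" "\<And>s. s \<in> S \<Longrightarrow> p s \<le> 1/2"
  shows "p = zeroS S"
proof -
  have "p = zeroS S \<or> p = oneS S"
    using varying[OF assms(1)] assms(2) by (auto simp: varying_def)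
  \<comment> \<open>The constant \<open>1\<close> is at most \<open>1/2\<close> only over empty
    \<open>S\<close>, where it coincides with \<open>0\<close>.\<close>
  moreover have "oneS S = zeroS S" if "p = oneS S"
  proof -
    have "S = {}"
      using assms(2) that by (force simp: oneS_def)
    then show ?thesis by (simp add: oneS_def zeroS_def)
  qed
  ultimately show ?thesis by auto
qed

lemma weighted_orth:
  assumes "p \<in> P" "q \<in> P" "a > 0" "b > 0"
    and le: "\<And>s. s \<in> S \<Longrightarrow> a * p s + b * q s \<le> (a + b) / 2"
  shows "addS S p q \<in> P" and "\<And>s. s \<in> S \<Longrightarrow> p s + q s \<le> 1"
proof -
  have "meet_zero S P p q"
    unfolding meet_zero_def
  proof (intro ballI impI, elim conjE)
    fix y assume y: "y \<in> P" "leS S y p" "leS S y q"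
    show "y = zeroS S"
    proof (rule eq_zeroI[OF y(1)])
      fix s assume s: "s \<in> S"
      have "a * y s + b * y s \<le> a * p s + b * q s"
        using y s assms(3,4) by (intro add_mono mult_left_mono) (auto simp: leS_def)
      with le[OF s] have "(a + b) * y s \<le> (a + b) * (1/2)"
        by (simp add: algebra_simps)
      then show "y s \<le> 1/2"
        using assms(3,4) by (subst (asm) mult_le_cancel_left_pos) auto
    qed
  qed
  then show mem: "addS S p q \<in> P"
    using specific assms(1,2) by (simp add: specific_def)
  show "p s + q s \<le> 1" if "s \<in> S" for s
    using sprob[OF mem] that by (auto simp: sprob_def addS_def)
qed

lemma orth_add_mem:
  assumes "p \<in> P" "q \<in> P" "\<And>s. s \<in> S \<Longrightarrow> p s + q s \<le> 1"
  shows "addS S p q \<in> P"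
  using weighted_orth(1)[OF assms(1,2), of 1 1] assms(3) by simp

text \<open>Were the meet zero, \<open>p + q\<close> would belong to \<open>P\<close> and hence be
  at most \<open>1\<close> on \<open>S\<close>.\<close>

lemma common_lower_bound:
  assumes "p \<in> P" "q \<in> P" "\<not> (\<forall>s\<in>S. p s + q s \<le> 1)"
  obtains z where "z \<in> P" "z \<noteq> zeroS S" "\<And>s. s \<in> S \<Longrightarrow> z s \<le> p s" "\<And>s. s \<in> S \<Longrightarrow> z s \<le> q s"
proof -
  have "\<not> meet_zero S P p q"
  proof
    assume "meet_zero S P p q"
    then have "addS S p q \<in> P"
      using specific assms(1,2) by (simp add: specific_def)
    from sprob[OF this] assms(3) show False
      by (auto simp: sprob_def addS_def)
  qed
  with that show thesis
    by (auto simp: meet_zero_def leS_def)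
qed

lemma pairwise_orth_add_mem:
  assumes P: "p \<in> P" "q \<in> P" "r \<in> P"
    and "orth S p q" "orth S p r" "orth S q r"
  shows "addS S (addS S p q) r \<in> P"
proof (rule ccontr)
  assume notin: "addS S (addS S p q) r \<notin> P"
  have pq: "p s + q s \<le> 1" and pr: "p s + r s \<le> 1" and qr: "q s + r s \<le> 1" if "s \<in> S" for s
    using assms that by (auto simp: orth_iff)
  have pqP: "addS S p q \<in> P"
    using orth_add_mem[OF P(1,2)] pq by simp
  have "\<not> (\<forall>s\<in>S. addS S p q s + r s \<le> 1)"
    using orth_add_mem[OF pqP P(3)] notin by blast
  then obtain x where x: "x \<in> P" "x \<noteq> zeroS S"
      "\<And>s. s \<in> S \<Longrightarrow> x s \<le> addS S p q s" "\<And>s. s \<in> S \<Longrightarrow> x s \<le> r s"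
    using common_lower_bound[OF pqP P(3)] by blast
  have x_pq: "x s \<le> p s + q s" and px: "p s + x s \<le> 1" and qx: "q s + x s \<le> 1" if "s \<in> S" for s
    using x(3,4)[OF that] pr[OF that] qr[OF that] that by (auto simp: addS_def)
  define t where "t = complS S (addS S p q)"
  have tP: "t \<in> P"
    unfolding t_def by (rule complS_mem[OF pqP])
  have t: "t s = 1 - p s - q s" if "s \<in> S" for s
    using that by (simp add: t_def complS_def addS_def)
  have nonneg: "0 \<le> u s" if "u \<in> P" "s \<in> S" for u s
    using sprob[OF that(1)] that(2) by (simp add: sprob_def)
  have pxP: "addS S p x \<in> P" and qxP: "addS S q x \<in> P"
    using orth_add_mem P x(1) px qx by auto
  \<comment> \<open>Otherwise \<open>x \<le> q\<close>, and \<open>q + x \<le> 1\<close> makes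
    \<open>x\<close> at most \<open>1/2\<close>.\<close>
  have "\<not> (\<forall>s\<in>S. t s + addS S p x s \<le> 1)"
  proof
    assume *: "\<forall>s\<in>S. t s + addS S p x s \<le> 1"
    have "x = zeroS S"
      by (rule eq_zeroI[OF x(1)]) (use * t qx in \<open>fastforce simp: addS_def\<close>)
    with x(2) show False ..
  qed
  then obtain z where z: "z \<in> P" "z \<noteq> zeroS S"
      "\<And>s. s \<in> S \<Longrightarrow> z s \<le> t s" "\<And>s. s \<in> S \<Longrightarrow> z s \<le> addS S p x s"
    using common_lower_bound[OF tP pxP] by blast
  have "\<not> (\<forall>s\<in>S. z s + addS S q x s \<le> 1)"
  proof
    assume "\<forall>s\<in>S. z s + addS S q x s \<le> 1"
    then have zqx: "z s + q s + x s \<le> 1" if "s \<in> S" for s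
      using that by (auto simp: addS_def)
    \<comment> \<open>Chosen so that \<open>x + g \<le> 1\<close> reads \<open>z \<le> p\<close>;
      since \<open>z \<le> t \<le> 1 - p\<close>, this gives \<open>z \<le> 1/2\<close>.\<close>
    define g where "g = addS S (complS S (addS S p x)) z"
    have g: "g s = 1 - p s - x s + z s" if "s \<in> S" for s
      using that by (simp add: g_def addS_def complS_def)
    have gP: "g \<in> P"
      unfolding g_def using z(4)
      by (intro orth_add_mem[OF complS_mem[OF pxP] z(1)]) (simp add: complS_def)
    have "z = zeroS S"
    proof (rule eq_zeroI[OF z(1)])
      fix s assume s: "s \<in> S"
      \<comment> \<open>Adding \<open>z + q + x \<le> 1\<close> and \<open>x \<le> p + q\<close>
        gives \<open>2 * x + z \<le> 1 + p\<close>, which is this bound.\<close>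
      have "3 * x s + 1 * g s \<le> (3 + 1) / 2" if "s \<in> S" for s
        using g[OF that] zqx[OF that] t[OF that] x_pq[OF that] by simp
      then have "x s + g s \<le> 1"
        using weighted_orth(2)[OF x(1) gP, of 3 1] s by simp
      then show "z s \<le> 1/2"
        using g[OF s] z(3)[OF s] t[OF s] nonneg[OF P(2) s] by simp
    qed
    with z(2) show False ..
  qed
  \<comment> \<open>This \<open>z'\<close> is the element called \<open>z\<close> in the overview;
    the \<open>z\<close> above is an intermediate step towards a common lower bound of
    \<open>t\<close>, \<open>p + x\<close> and \<open>q + x\<close>.\<close>
  then obtain z' where z': "z' \<in> P" "z' \<noteq> zeroS S"
      "\<And>s. s \<in> S \<Longrightarrow> z' s \<le> z s" "\<And>s. s \<in> S \<Longrightarrow> z' s \<le> addS S q x s"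
    using common_lower_bound[OF z(1) qxP] by blast
  have z'_t: "z' s \<le> t s" and z'_px: "z' s \<le> p s + x s" and z'_qx: "z' s \<le> q s + x s"
    if "s \<in> S" for s
    using z'(3,4)[OF that] z(3,4)[OF that] that by (auto simp: addS_def)
  have xzP: "addS S x z' \<in> P"
    by (rule orth_add_mem[OF x(1) z'(1)]) (use z'_t t x_pq in fastforce)
  \<comment> \<open>Otherwise \<open>z' \<le> p + x \<le> 1 - z'\<close>.\<close>
  have "\<not> (\<forall>s\<in>S. p s + addS S x z' s \<le> 1)"
  proof
    assume *: "\<forall>s\<in>S. p s + addS S x z' s \<le> 1"
    have "z' = zeroS S"
      by (rule eq_zeroI[OF z'(1)]) (use * z'_px in \<open>fastforce simp: addS_def\<close>)
    with z'(2) show False ..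
  qed
  then obtain w where w: "w \<in> P" "w \<noteq> zeroS S"
      "\<And>s. s \<in> S \<Longrightarrow> w s \<le> p s" "\<And>s. s \<in> S \<Longrightarrow> w s \<le> addS S x z' s"
    using common_lower_bound[OF P(1) xzP] by blast
  \<comment> \<open>As with \<open>g\<close>, the inequality \<open>z' + h \<le> 1\<close> reads
    \<open>w \<le> x\<close>.\<close>
  define h where "h = addS S (complS S (addS S x z')) w"
  have h: "h s = 1 - x s - z' s + w s" if "s \<in> S" for s
    using that by (simp add: h_def addS_def complS_def)
  have hP: "h \<in> P"
    unfolding h_def using w(4)
    by (intro orth_add_mem[OF complS_mem[OF xzP] w(1)]) (simp add: complS_def)
  have "w = zeroS S"
  proof (rule eq_zeroI[OF w(1)])
    fix s assume s: "s \<in> S"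
    \<comment> \<open>The left side is \<open>1 - x + 2 * z' + w\<close>: one \<open>z'\<close> is
      bounded by \<open>1 - p - q\<close>, the other by \<open>q + x\<close>, and \<open>w\<close>
      by \<open>p\<close>.\<close>
    have "3 * z' s + 1 * h s \<le> (3 + 1) / 2" if "s \<in> S" for s
      using h[OF that] z'_t[OF that] z'_qx[OF that] w(3)[OF that] t[OF that] by simp
    then have "z' s + h s \<le> 1"
      using weighted_orth(2)[OF z'(1) hP, of 3 1] s by simp
    then show "w s \<le> 1/2"
      using h[OF s] w(3)[OF s] px[OF s] by simp
  qed
  with w(2) show False ..
qed

lemma prob_algebra: "prob_algebra S P"
  using specific pairwise_orth_add_mem by (simp add: prob_algebra_def specific_def)

end

section \<open>Algebras of S-probabilities: varying elements, specificity and commuting\<close>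

locale algebra_of_probabilities =
  fixes S :: "'s set" and P :: "('s \<Rightarrow> real) set"
  assumes algebra: "prob_algebra S P"
begin

lemma sprob: "p \<in> P \<Longrightarrow> sprob S p"
  and zero_mem: "zeroS S \<in> P"
  and complS_mem: "p \<in> P \<Longrightarrow> complS S p \<in> P"
  using algebra by (simp_all add: prob_algebra_def)

lemma nonneg: "p \<in> P \<Longrightarrow> s \<in> S \<Longrightarrow> 0 \<le> p s"
  and le_one: "p \<in> P \<Longrightarrow> s \<in> S \<Longrightarrow> p s \<le> 1"
  using sprob by (auto simp: sprob_def)

lemma add3_mem:
  assumes "p \<in> P" "q \<in> P" "r \<in> P" "orth S p q" "orth S p r" "orth S q r"
  shows "addS S (addS S p q) r \<in> P"
  using algebra assms by (simp add: prob_algebra_def)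

text \<open>Taking for \<open>r\<close> the complement of a common upper bound \<open>u\<close> of
  orthogonal \<open>p\<close> and \<open>q\<close> yields \<open>p + q \<le> u\<close>; infima and
  suprema are verified this way.\<close>

lemma add3_le_one:
  assumes "p \<in> P" "q \<in> P" "r \<in> P" "orth S p q" "orth S p r" "orth S q r" "s \<in> S"
  shows "p s + q s + r s \<le> 1"
  using le_one[OF add3_mem[OF assms(1-6)] assms(7)] assms(7) by (simp add: addS_def)

lemma add_mem:
  assumes "p \<in> P" "q \<in> P" "orth S p q"
  shows "addS S p q \<in> P"
proof -
  have "orth S u (zeroS S)" if "u \<in> P" for u
    using le_one[OF that] by (simp add: orth_iff zeroS_def)
  then have "addS S (addS S p q) (zeroS S) \<in> P"
    using add3_mem[OF assms(1,2) zero_mem assms(3)] assms by blast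
  also have "addS S (addS S p q) (zeroS S) = addS S p q"
    by (auto simp: addS_def zeroS_def)
  finally show ?thesis .
qed

text \<open>If \<open>u \<le> 1/2\<close>, then \<open>u\<close>, \<open>u\<close> and \<open>1 - u\<close> are pairwise orthogonal.\<close>

lemma eq_zeroI:
  assumes u: "u \<in> P" and half: "\<And>s. s \<in> S \<Longrightarrow> u s \<le> 1/2"
  shows "u = zeroS S"
proof (rule sprob_eqI[OF sprob[OF u] sprob_zeroS])
  fix s assume s: "s \<in> S"
  have "u s + u s + complS S u s \<le> 1"
  proof (rule add3_le_one[OF u u complS_mem[OF u] _ _ _ s])
    show "orth S u u"
      using half by (fastforce simp: orth_iff)
  qed (simp_all add: orth_iff complS_def)
  with s nonneg[OF u s] show "u s = zeroS S s"
    by (simp add: complS_def zeroS_def)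
qed

lemma varying:
  assumes p: "p \<in> P"
  shows "varying S p"
  unfolding varying_def
proof (intro impI, elim disjE)
  assume "\<forall>s\<in>S. p s \<le> 1/2"
  then show "p = zeroS S \<or> p = oneS S"
    using eq_zeroI[OF p] by blast
next
  assume "\<forall>s\<in>S. p s \<ge> 1/2"
  then have "complS S p = zeroS S"
    by (intro eq_zeroI[OF complS_mem[OF p]]) (auto simp: complS_def)
  then have zero: "complS S p s = 0" for s
    by (simp add: zeroS_def)
  have "p s = oneS S s" for s
    using zero[of s] sprob[OF p] by (cases "s \<in> S") (auto simp: complS_def oneS_def sprob_def)
  then show "p = zeroS S \<or> p = oneS S" by blast
qed

text \<open>If \<open>0\<close> is the infimum of \<open>p\<close> and \<open>q\<close>,
  faithfulness makes \<open>p\<close> the supremum of \<open>0\<close> and some \<open>b\<close>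
  below the complement of \<open>q\<close>, so \<open>p\<close> is orthogonal to
  \<open>q\<close>.\<close>

lemma specificI:
  assumes "inf_faithful S P"
  shows "specific S P"
proof -
  have "addS S p q \<in> P" if pq: "p \<in> P" "q \<in> P" and zero: "meet_zero S P p q" for p q
  proof (rule add_mem[OF pq])
    have inf0: "is_inf S P p q (zeroS S)"
      unfolding is_inf_def
    proof (intro conjI ballI impI)
      show "zeroS S \<in> P" by (rule zero_mem)
      show "leS S (zeroS S) p" "leS S (zeroS S) q"
        using pq by (auto simp: leS_def zeroS_def nonneg)
      show "leS S x (zeroS S)" if "x \<in> P" "leS S x p \<and> leS S x q" for x
        using zero that unfolding meet_zero_def by (metis leS_def order_refl)
    qed
    then obtain a b where a: "is_inf S P p q a" and b: "is_inf S P p (complS S q) b"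
        and p: "is_sup S P a b p"
      using assms pq unfolding inf_faithful_def commute_def by blast
    have "a = zeroS S"
      using a zero by (auto simp: is_inf_def meet_zero_def)
    moreover have "b \<in> P" "leS S b (complS S q)"
      using b by (auto simp: is_inf_def)
    moreover from this have "leS S (zeroS S) b"
      using nonneg by (auto simp: leS_def zeroS_def)
    ultimately have "leS S p b"
      using p by (auto simp: is_sup_def leS_def)
    with \<open>leS S b (complS S q)\<close> show "orth S p q"
      by (force simp: orth_def leS_def)
  qed
  then show ?thesis
    using algebra by (simp add: specific_def prob_algebra_def)
qed

text \<open>The differences \<open>d = p - c\<close> and \<open>e = q - c\<close> have meet zero, so
  specificity makes them orthogonal. Then \<open>c\<close>, \<open>d\<close>, \<open>e\<close> are
  pairwise orthogonal, and \<open>d + e + c \<le> 1\<close> says \<open>d \<le> 1 - q\<close>. This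
  \<open>d\<close> is the infimum of \<open>p\<close> and the complement of
  \<open>q\<close>.\<close>

lemma inf_imp_commute:
  assumes specific: "specific S P" and pq: "p \<in> P" "q \<in> P" and c: "is_inf S P p q c"
  shows "commute S P p q"
proof -
  have cP: "c \<in> P" and cp: "\<And>s. s \<in> S \<Longrightarrow> c s \<le> p s" and cq: "\<And>s. s \<in> S \<Longrightarrow> c s \<le> q s"
    and greatest: "\<And>y s. y \<in> P \<Longrightarrow> leS S y p \<Longrightarrow> leS S y q \<Longrightarrow> s \<in> S \<Longrightarrow> y s \<le> c s"
    using c by (auto simp: is_inf_def leS_def)
  have diff: "\<exists>d\<in>P. \<forall>s\<in>S. d s = u s - c s" if "u \<in> P" "\<And>s. s \<in> S \<Longrightarrow> c s \<le> u s" for u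
  proof
    \<comment> \<open>\<open>u - c = 1 - ((1 - u) + c)\<close>, where \<open>1 - u\<close> and
      \<open>c\<close> are orthogonal.\<close>
    show "complS S (addS S (complS S u) c) \<in> P"
      using that cP by (intro complS_mem add_mem) (auto simp: orth_iff complS_def)
  qed (simp add: complS_def addS_def)
  obtain d where dP: "d \<in> P" and d: "\<And>s. s \<in> S \<Longrightarrow> d s = p s - c s"
    using diff[OF pq(1) cp] by blast
  obtain e where eP: "e \<in> P" and e: "\<And>s. s \<in> S \<Longrightarrow> e s = q s - c s"
    using diff[OF pq(2) cq] by blast
  have "meet_zero S P d e"
    unfolding meet_zero_def
  proof (intro ballI impI, elim conjE)
    fix y assume y: "y \<in> P" and yd: "leS S y d" and ye: "leS S y e"
    have y_le: "y s + c s \<le> p s" "y s + c s \<le> q s" if "s \<in> S" for s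
      using yd ye d[OF that] e[OF that] that by (force simp: leS_def)+
    have "orth S y c"
      using y_le(1) le_one[OF pq(1)] by (fastforce simp: orth_iff)
    then have sum: "addS S y c \<in> P"
      by (rule add_mem[OF y cP])
    \<comment> \<open>\<open>y + c\<close> is again a common lower bound of \<open>p\<close> and
      \<open>q\<close>, hence below \<open>c\<close>.\<close>
    have "y s \<le> 0" if "s \<in> S" for s
      using greatest[OF sum _ _ that] y_le that by (auto simp: leS_def addS_def)
    then show "y = zeroS S"
      using nonneg[OF y]
      by (intro sprob_eqI[OF sprob[OF y] sprob_zeroS]) (force simp: zeroS_def)
  qed
  then have "addS S d e \<in> P"
    using specific dP eP by (simp add: specific_def)
  then have de: "d s + e s \<le> 1" if "s \<in> S" for s
    using le_one that by (force simp: addS_def)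
  have "d s + e s + c s \<le> 1" if "s \<in> S" for s
  proof (rule add3_le_one[OF dP eP cP _ _ _ that])
    show "orth S d e" "orth S d c" "orth S e c"
      using de d e le_one[OF pq(1)] le_one[OF pq(2)] by (auto simp: orth_iff)
  qed
  then have d_le: "d s \<le> 1 - q s" if "s \<in> S" for s
    using e that by fastforce
  have "is_inf S P p (complS S q) d"
    unfolding is_inf_def
  proof (intro conjI ballI impI)
    show "d \<in> P" by (rule dP)
    show "leS S d p"
      using d nonneg[OF cP] by (auto simp: leS_def)
    show "leS S d (complS S q)"
      using d_le by (auto simp: leS_def complS_def)
  next
    fix y assume y: "y \<in> P" and "leS S y p \<and> leS S y (complS S q)"
    then have yp: "leS S y p" and yq: "leS S y (complS S q)"
      by blast+
    have "y s + c s + complS S p s \<le> 1" if "s \<in> S" for s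
    proof (rule add3_le_one[OF y cP complS_mem[OF pq(1)] _ _ _ that])
      show "orth S y c"
        using yq cq by (fastforce simp: orth_iff leS_def complS_def)
    qed (use yp cp in \<open>auto simp: orth_iff leS_def complS_def\<close>)
    then show "leS S y d"
      using d by (fastforce simp: leS_def complS_def)
  qed
  moreover have "is_sup S P c d p"
    unfolding is_sup_def
  proof (intro conjI ballI impI)
    show "p \<in> P" by (rule pq(1))
    show "leS S c p" "leS S d p"
      using cp d nonneg[OF cP] by (auto simp: leS_def)
  next
    fix u assume u: "u \<in> P" and "leS S c u \<and> leS S d u"
    then have cu: "leS S c u" and du: "leS S d u"
      by blast+
    have "c s + d s + complS S u s \<le> 1" if "s \<in> S" for s
    proof (rule add3_le_one[OF cP dP complS_mem[OF u] _ _ _ that])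
      show "orth S c d"
        using d le_one[OF pq(1)] by (auto simp: orth_iff)
    qed (use cu du in \<open>auto simp: orth_iff leS_def complS_def\<close>)
    then show "leS S p u"
      using d by (fastforce simp: leS_def complS_def)
  qed
  ultimately show ?thesis
    using c unfolding commute_def by blast
qed

text \<open>The other direction is immediate, since commuting includes the existence of the
  infimum.\<close>

lemma inf_faithfulI:
  assumes "specific S P"
  shows "inf_faithful S P"
  using inf_imp_commute[OF assms] by (auto simp: inf_faithful_def commute_def)

end

theorem theorem2p6:
  fixes S :: "'s set" and P :: "('s \<Rightarrow> real) set"
  assumes "\<forall>p\<in>P. sprob S p"
  shows "(specific S P \<and> (\<forall>p\<in>P. varying S p)) \<longleftrightarrow> (prob_algebra S P \<and> inf_faithful S P)"
proof
  assume "specific S P \<and> (\<forall>p\<in>P. varying S p)"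
  then interpret specific_varying S P
    by unfold_locales auto
  interpret algebra_of_probabilities S P
    by unfold_locales (rule prob_algebra)
  show "prob_algebra S P \<and> inf_faithful S P"
    using prob_algebra inf_faithfulI[OF specific] by blast
next
  assume *: "prob_algebra S P \<and> inf_faithful S P"
  then interpret algebra_of_probabilities S P
    by unfold_locales auto
  show "specific S P \<and> (\<forall>p\<in>P. varying S p)"
    using * specificI varying by blast
qed

end
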